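(* For all integers $k \geq 1$ and $l \geq 2$, $$c_{k,l} \geq 1 - \frac{2}{k!}\sum^{\lfloor k/(l+1) \rfloor}_{i=0} (-1)^i \binom{k}{i} \left(\frac{k}{l+1}-i\right)^k$$ and $$\tilde{c}_{k,l} \geq 1 - \frac{2}{k!}\sum^{\lfloor k/(l+1) \rfloor}_{i=0} (-1)^i \binom{k}{i} \left(\frac{k}{l+1}-i\right)^k.$$
   Context: A subset $A$ of an additive group is called $l$-fold-sumfree if $x_1+x_2+\cdots+x_l \neq z$ for all $x_1,\ldots,x_l,z\in A$ (not necessarily distinct). Subsets of $\{1,\ldots,n\}^k$ are regarded as subsets of the additive group $\mathbb{Z}^k$, subsets of $[0,1]^k$ as subsets of the additive group $\mathbb{R}^k$, and $\mathrm{Vol}$ denotes Lebesgue measure on $\mathbb{R}^k$. Define $$c_{k,l} := \limsup_{n \to \infty} \frac{1}{n^k} \max \{\#S : S \subset \{1,\ldots,n\}^k \text{ is } l\text{-fold-sumfree}\},$$ $$\tilde{c}_{k,l} := \sup \{\mathrm{Vol}(S) : S \subset [0,1]^k \text{ is Lebesgue measurable and } l\text{-fold-sumfree}\}.$$ *)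

theory Defs
  imports "HOL-Analysis.Analysis"
begin

definition fold_sumfree :: "nat \<Rightarrow> 'a::ab_group_add set \<Rightarrow> bool" where
  "fold_sumfree l A \<longleftrightarrow> (\<forall>x z. (\<forall>i<l. x i \<in> A) \<and> z \<in> A \<longrightarrow> (\<Sum>i<l. x i) \<noteq> z)"

text \<open>
  The dimension \<open>k \<ge> 1\<close> is the cardinality of a finite index type \<open>'k\<close>, passed as \<open>TYPE('k)\<close>.
  Both constants lie in the interval from 0 to 1; they are valued in the extended reals so that the
  limit superior and the supremum are taken in a complete lattice and need no boundedness side
  conditions.
\<close>

definition int_grid :: "nat \<Rightarrow> (int ^ 'k::finite) set" where
  "int_grid n = {x. \<forall>i. x $ i \<in> {1..int n}}"

definition unit_cube :: "(real ^ 'k::finite) set" where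
  "unit_cube = {x. \<forall>i. x $ i \<in> {0..1}}"

definition c_discrete :: "'k::finite itself \<Rightarrow> nat \<Rightarrow> ereal" where
  "c_discrete _ l = limsup (\<lambda>n. ereal (1 / real n ^ CARD('k) *
     real (Max {card S | S :: (int ^ 'k) set. S \<subseteq> int_grid n \<and> fold_sumfree l S})))"

definition c_continuous :: "'k::finite itself \<Rightarrow> nat \<Rightarrow> ereal" where
  "c_continuous _ l = Sup {ereal (measure lebesgue S) | S :: (real ^ 'k) set.
     S \<subseteq> unit_cube \<and> S \<in> sets lebesgue \<and> fold_sumfree l S}"

end

theory Submission
  imports Defs
begin

text \<open>
  With \<open>t = k / (l + 1)\<close>, the points of the cube whose coordinate sum lies in \<open>[t, l t)\<close> form an
  \<open>l\<close>-fold-sumfree set: an \<open>l\<close>-fold sum of such points has coordinate sum at least \<open>l t\<close>. Since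
  \<open>k - l t = t\<close>, the reflection \<open>x \<mapsto> 1 - x\<close> maps the excluded upper corner to the lower one, so both
  have volume at most the Irwin--Hall distribution function at \<open>t\<close>. For the grid, disjoint open
  cubes of side \<open>1 / n\<close> with upper corner \<open>x / n\<close> compare counts with volumes; reflection now
  shifts the bound to \<open>t + k / n\<close>, which is harmless by continuity.
\<close>

section \<open>The Irwin--Hall distribution function\<close>

text \<open>For \<open>k \<ge> 1\<close> this is the probability that \<open>k\<close> independent
  uniform variables on \<open>[0,1]\<close> sum to at most \<open>s\<close>. Truncated powers over a
  fixed range of \<open>i\<close> make continuity in \<open>s\<close> evident, which a floor as
  summation bound would hide.\<close>

definition irwin_hall_cdf :: "nat \<Rightarrow> real \<Rightarrow> real" where
  "irwin_hall_cdf k s = (\<Sum>i\<le>k. (-1) ^ i * real (k choose i) * max 0 (s - real i) ^ k) / fact k"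

text \<open>The terms beyond the floor of \<open>s\<close> carry the factor \<open>0 ^ k\<close>,
  which vanishes since \<open>k \<ge> 1\<close>. This recovers the form of the sum used in the
  theorem.\<close>

lemma irwin_hall_cdf_truncate:
  assumes "k \<ge> 1" "0 \<le> s" "s \<le> real k"
  shows "irwin_hall_cdf k s =
    (\<Sum>i = 0..nat \<lfloor>s\<rfloor>. (-1) ^ i * real (k choose i) * (s - real i) ^ k) / fact k"
proof -
  have le: "nat \<lfloor>s\<rfloor> \<le> k"
    using assms by linarith
  have "(\<Sum>i = 0..nat \<lfloor>s\<rfloor>. (-1) ^ i * real (k choose i) * (s - real i) ^ k) =
        (\<Sum>i\<le>k. (-1) ^ i * real (k choose i) * max 0 (s - real i) ^ k)"
  proof (rule sum.mono_neutral_cong_left)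
    show "\<forall>i\<in>{..k} - {0..nat \<lfloor>s\<rfloor>}. (-1) ^ i * real (k choose i) * max 0 (s - real i) ^ k = 0"
    proof
      fix i assume "i \<in> {..k} - {0..nat \<lfloor>s\<rfloor>}"
      then have "s - real i \<le> 0"
        by (auto simp: not_le) linarith
      then show "(-1) ^ i * real (k choose i) * max 0 (s - real i) ^ k = 0"
        using assms(1) by (simp add: max_def)
    qed
    fix i assume "i \<in> {0..nat \<lfloor>s\<rfloor>}"
    then have "0 \<le> s - real i"
      using assms by (auto simp: le_nat_iff le_floor_iff)
    then show "(-1) ^ i * real (k choose i) * (s - real i) ^ k =
        (-1) ^ i * real (k choose i) * max 0 (s - real i) ^ k"
      by simp
  qed (use le in auto)
  then show ?thesis
    by (simp add: irwin_hall_cdf_def)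
qed

lemma continuous_irwin_hall_cdf: "isCont (irwin_hall_cdf k) s"
  unfolding irwin_hall_cdf_def[abs_def] by (intro continuous_intros) auto

text \<open>Grouping subsets by cardinality turns an inclusion--exclusion sum into one with binomial
  coefficients.\<close>

lemma sum_Pow_card:
  fixes f :: "nat \<Rightarrow> real"
  assumes "finite A"
  shows "(\<Sum>I\<in>Pow A. f (card I)) = (\<Sum>i\<le>card A. real (card A choose i) * f i)"
proof -
  have "(\<Sum>I\<in>Pow A. f (card I)) = (\<Sum>i\<le>card A. \<Sum>I\<in>{I \<in> Pow A. card I = i}. f (card I))"
    by (rule sum.group[symmetric]) (use assms in \<open>auto intro: card_mono\<close>)
  also have "\<dots> = (\<Sum>i\<le>card A. real (card A choose i) * f i)"
    by (rule sum.cong) (use n_subsets[OF assms] in \<open>auto simp: Pow_def\<close>)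
  finally show ?thesis .
qed

section \<open>Volume of a corner simplex\<close>

definition corner_simplex :: "real \<Rightarrow> (real ^ 'k::finite) set" where
  "corner_simplex s = {x. (\<forall>i. 0 \<le> x $ i) \<and> (\<Sum>i\<in>UNIV. x $ i) \<le> s}"

lemma compact_corner_simplex: "compact (corner_simplex s :: (real ^ 'k::finite) set)"
proof -
  have "corner_simplex s \<subseteq> cbox (0 :: real ^ 'k) (\<chi> i. s)"
  proof
    fix x :: "real ^ 'k" assume x: "x \<in> corner_simplex s"
    have "x $ i \<le> s" for i
      using member_le_sum[of i UNIV "\<lambda>i. x $ i"] x by (auto simp: corner_simplex_def)
    then show "x \<in> cbox 0 (\<chi> i. s)"
      using x by (auto simp: mem_box_cart corner_simplex_def)
  qed
  moreover have "closed (corner_simplex s :: (real ^ 'k) set)"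
    unfolding corner_simplex_def
    by (intro closed_Collect_conj closed_Collect_all closed_Collect_le continuous_intros)
  ultimately show ?thesis
    by (meson bounded_cbox bounded_subset compact_eq_bounded_closed)
qed

lemma sum_inner_Basis_cart: "(\<Sum>b\<in>Basis. x \<bullet> b) = (\<Sum>i\<in>UNIV. x $ i)" for x :: "real ^ 'k::finite"
proof -
  have "(\<Sum>b\<in>Basis. x \<bullet> b) = (\<Sum>b\<in>(\<lambda>i. axis i 1) ` UNIV. x \<bullet> b)"
    by (rule sum.cong) (auto simp: Basis_vec_def)
  also have "\<dots> = (\<Sum>i\<in>UNIV. x $ i)"
    by (subst sum.reindex) (auto simp: inj_on_def axis_eq_axis inner_axis)
  finally show ?thesis .
qed

text \<open>Links the coordinate description to the standard simplex, whose volume is known to be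
  \<open>1 / fact CARD('k)\<close>.\<close>

lemma corner_simplex_1: "corner_simplex 1 = (convex hull insert 0 Basis :: (real ^ 'k::finite) set)"
  unfolding std_simplex corner_simplex_def sum_inner_Basis_cart
  by (auto simp: Basis_vec_def inner_axis)

text \<open>For \<open>s > 0\<close> the set is the unit simplex scaled by \<open>s\<close>, which
  multiplies volume by \<open>s ^ CARD('k)\<close>. Otherwise it contains at most the origin and is
  negligible.\<close>

lemma measure_corner_simplex:
  "measure lebesgue (corner_simplex s :: (real ^ 'k::finite) set) = max 0 s ^ CARD('k) / fact CARD('k)"
proof -
  \<comment> \<open>The summand \<open>+ 0\<close> gives the map the affine shape expected by
    \<open>measure_lebesgue_affine\<close>.\<close>
  have sub: "corner_simplex s = ((\<lambda>x. s *\<^sub>R x + 0) ` corner_simplex 1 :: (real ^ 'k) set)" if "s > 0"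
  proof (intro set_eqI iffI)
    fix x :: "real ^ 'k" assume "x \<in> corner_simplex s"
    then have "(1/s) *\<^sub>R x \<in> corner_simplex 1"
      using that by (auto simp: corner_simplex_def divide_le_eq simp flip: sum_divide_distrib)
    then show "x \<in> (\<lambda>x. s *\<^sub>R x + 0) ` corner_simplex 1"
      using that by (intro image_eqI[of _ _ "(1/s) *\<^sub>R x"]) auto
  next
    fix x :: "real ^ 'k" assume "x \<in> (\<lambda>x. s *\<^sub>R x + 0) ` corner_simplex 1"
    then show "x \<in> corner_simplex s"
      using that by (auto simp: corner_simplex_def mult_left_le simp flip: sum_distrib_left)
  qed
  have one: "measure lebesgue (corner_simplex 1 :: (real ^ 'k) set) = 1 / fact CARD('k)"
    using compact_corner_simplex[of 1, where 'k='k] content_std_simplex[where 'a="real ^ 'k"]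
    by (simp add: corner_simplex_1 measure_completion borel_compact)
  show ?thesis
  proof (cases "s > 0")
    case True
    then show ?thesis
      by (simp only: sub[OF True] measure_lebesgue_affine one) simp
  next
    case False
    have "corner_simplex s \<subseteq> {0 :: real ^ 'k}"
    proof
      fix x :: "real ^ 'k" assume x: "x \<in> corner_simplex s"
      then have "(\<Sum>i\<in>UNIV. x $ i) = 0"
        using False sum_nonneg[of UNIV "\<lambda>i. x $ i"] by (auto simp: corner_simplex_def)
      then show "x \<in> {0}"
        using x by (subst (asm) sum_nonneg_eq_0_iff) (auto simp: corner_simplex_def vec_eq_iff)
    qed
    then have "negligible (corner_simplex s :: (real ^ 'k) set)"
      by (meson negligible_sing negligible_subset)
    then show ?thesis
      using False by (simp add: negligible_imp_measure0)
  qed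
qed

section \<open>Volume of a slice of the cube\<close>

text \<open>The cube is half-open so that a point of \<open>corner_simplex s\<close> leaves it
  exactly when some coordinate satisfies \<open>1 \<le> x $ i\<close>, a condition that cuts out
  translates of closed simplices.\<close>

definition cube_slice :: "real \<Rightarrow> (real ^ 'k::finite) set" where
  "cube_slice s = {x. (\<forall>i. 0 \<le> x $ i \<and> x $ i < 1) \<and> (\<Sum>i\<in>UNIV. x $ i) \<le> s}"

text \<open>Inclusion--exclusion over the set \<open>I\<close> of coordinates that are at least 1; each term is a
  translated simplex.\<close>
lemma has_bochner_integral_indicator_cube_slice:
  "has_bochner_integral lebesgue (indicator (cube_slice s :: (real ^ 'k::finite) set))
     (irwin_hall_cdf CARD('k) s)"
proof -
  \<comment> \<open>Adding 1 to each coordinate in \<open>I\<close> raises the coordinate sum by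
    \<open>card I\<close>, hence the reduced bound \<open>s - real (card I)\<close>.\<close>
  define T :: "'k set \<Rightarrow> (real ^ 'k) set" where
    "T I = (+) (\<chi> i. indicator I i) ` corner_simplex (s - real (card I))" for I
  have T: "x \<in> T I \<longleftrightarrow> x \<in> corner_simplex s \<and> (\<forall>i\<in>I. 1 \<le> x $ i)" for x I
  proof -
    have *: "(\<Sum>i\<in>UNIV. x $ i - indicator I i) = (\<Sum>i\<in>UNIV. x $ i) - real (card I)"
      by (simp add: sum_subtractf indicator_def)
    have "0 \<le> x $ i - indicator I i \<longleftrightarrow> 0 \<le> x $ i \<and> (i \<in> I \<longrightarrow> 1 \<le> x $ i)" for i
      by (cases "i \<in> I") auto
    then have **: "(\<forall>i. 0 \<le> x $ i - indicator I i) \<longleftrightarrow> (\<forall>i. 0 \<le> x $ i) \<and> (\<forall>i\<in>I. 1 \<le> x $ i)"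
      by blast
    have "x \<in> T I \<longleftrightarrow> x - (\<chi> i. indicator I i) \<in> corner_simplex (s - real (card I))"
      unfolding T_def by (auto simp: image_iff algebra_simps intro!: bexI[of _ "x - (\<chi> i. indicator I i)"])
    also have "\<dots> \<longleftrightarrow> x \<in> corner_simplex s \<and> (\<forall>i\<in>I. 1 \<le> x $ i)"
      using ** by (auto simp: corner_simplex_def *)
    finally show ?thesis .
  qed
  have ind: "indicator (cube_slice s) x = (\<Sum>I\<in>Pow UNIV. (-1) ^ card I * indicator (T I) x :: real)"
    for x :: "real ^ 'k"
  proof (cases "x \<in> corner_simplex s")
    case True
    \<comment> \<open>Each factor is 0 or 1 and detects a coordinate below 1; expanding the product
      by \<open>prod_add\<close> yields one signed term per subset \<open>I\<close>.\<close>
    have "indicator (cube_slice s) x = (\<Prod>i\<in>UNIV. - of_bool (1 \<le> x $ i) + 1 :: real)"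
    proof (cases "x \<in> cube_slice s")
      case True
      then show ?thesis by (auto simp: cube_slice_def not_le[symmetric])
    next
      case False
      then obtain i where "1 \<le> x $ i"
        using \<open>x \<in> corner_simplex s\<close> by (auto simp: cube_slice_def corner_simplex_def not_less)
      then have "(\<Prod>i\<in>UNIV. - of_bool (1 \<le> x $ i) + 1 :: real) = 0"
        by (intro prod_zero) auto
      then show ?thesis using False by simp
    qed
    also have "\<dots> = (\<Sum>I\<in>Pow UNIV. (\<Prod>i\<in>I. - of_bool (1 \<le> x $ i)))"
      by (subst prod_add) auto
    also have "\<dots> = (\<Sum>I\<in>Pow UNIV. (-1) ^ card I * indicator (T I) x)"
    proof (rule sum.cong)
      fix I :: "'k set"
      have "(\<Prod>i\<in>I. - of_bool (1 \<le> x $ i)) = (-1) ^ card I * (\<Prod>i\<in>I. of_bool (1 \<le> x $ i) :: real)"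
        by (simp add: prod_uminus)
      also have "(\<Prod>i\<in>I. of_bool (1 \<le> x $ i) :: real) = indicator (T I) x"
        using True by (auto simp: T indicator_def prod_zero_iff)
      finally show "(\<Prod>i\<in>I. - of_bool (1 \<le> x $ i)) = (-1) ^ card I * (indicator (T I) x :: real)" .
    qed simp
    finally show ?thesis .
  next
    case False
    then have "x \<notin> cube_slice s"
      by (auto simp: cube_slice_def corner_simplex_def)
    with False show ?thesis by (simp add: T)
  qed
  have lm: "T I \<in> lmeasurable" for I
    unfolding T_def by (intro measurable_translation lmeasurable_compact compact_corner_simplex)
  have lm_finite: "emeasure lebesgue (T I) < \<infinity>" for I
    using lm[of I] unfolding fmeasurable_def by blast
  have "has_bochner_integral lebesgue (\<lambda>x. \<Sum>I\<in>Pow UNIV. (-1) ^ card I * indicator (T I) x)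
      (\<Sum>I\<in>Pow UNIV. (-1) ^ card I * measure lebesgue (T I))"
    by (intro has_bochner_integral_sum has_bochner_integral_mult_right
        has_bochner_integral_real_indicator fmeasurableD[OF lm] lm_finite)
  moreover have "(\<Sum>I\<in>Pow UNIV. (-1) ^ card I * measure lebesgue (T I)) =
     (\<Sum>I\<in>Pow (UNIV::'k set). (-1) ^ card I * (max 0 (s - real (card I)) ^ CARD('k) / fact CARD('k)))"
    by (simp add: T_def measure_translation measure_corner_simplex)
  moreover have "\<dots> = irwin_hall_cdf CARD('k) s"
    by (subst sum_Pow_card) (simp_all add: irwin_hall_cdf_def sum_divide_distrib mult_ac)
  ultimately show ?thesis
    by (simp add: ind[abs_def])
qed

text \<open>Measurability and finite volume are both read off from integrability of the
  indicator.\<close>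

lemma lmeasurable_cube_slice: "(cube_slice s :: (real ^ 'k::finite) set) \<in> lmeasurable"
  using has_bochner_integral_indicator_cube_slice[of s]
  by (auto simp: has_bochner_integral_iff integrable_indicator_iff fmeasurable_def)

lemma measure_cube_slice:
  "measure lebesgue (cube_slice s :: (real ^ 'k::finite) set) = irwin_hall_cdf CARD('k) s"
  using has_bochner_integral_indicator_cube_slice[of s, where 'k='k]
  by (auto simp: has_bochner_integral_iff)

section \<open>Counting grid points by volume\<close>

lemma measure_box_cart_const:
  assumes "0 \<le> c"
  shows "measure lebesgue (box a (a + (\<chi> i. c)) :: (real ^ 'k::finite) set) = c ^ CARD('k)"
proof -
  have c: "(\<chi> i. c) \<bullet> b = c" if "b \<in> Basis" for b :: "real ^ 'k"
    using that by (auto simp: Basis_vec_def inner_axis)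
  have "measure lborel (box a (a + (\<chi> i. c)) :: (real ^ 'k) set) = c ^ CARD('k)"
    using assms by (simp add: measure_lborel_box_eq inner_add_left c)
  then show ?thesis by (simp add: measure_completion)
qed

text \<open>The cubes attached to points of \<open>A\<close> are disjoint, have volume
  \<open>1 / n ^ CARD('k)\<close> each and lie in \<open>cube_slice s\<close>. Placing
  \<open>x / n\<close> at the upper corner means that coordinate sums inside a cube stay below that
  of \<open>x / n\<close>, so \<open>s\<close> needs no correction.\<close>

lemma card_le_irwin_hall_cdf:
  fixes A :: "(int ^ 'k::finite) set"
  assumes "n > 0" "A \<subseteq> int_grid n" "\<And>x. x \<in> A \<Longrightarrow> real_of_int (\<Sum>i\<in>UNIV. x $ i) \<le> s * real n"
  shows "real (card A) \<le> real n ^ CARD('k) * irwin_hall_cdf CARD('k) s"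
proof (cases "finite A")
  case True
  define lo :: "int ^ 'k \<Rightarrow> real ^ 'k" where "lo x = (\<chi> i. (real_of_int (x $ i) - 1) / n)" for x
  define Q where "Q x = box (lo x) (lo x + (\<chi> i. 1 / n))" for x
  have Q: "y \<in> Q x \<longleftrightarrow> (\<forall>i. real_of_int (x $ i) - 1 < n * y $ i \<and> n * y $ i < real_of_int (x $ i))" for x y
    using assms(1) by (auto simp: Q_def lo_def mem_box_cart field_simps)
  have disj: "disjnt (Q x) (Q y)" if "x \<noteq> y" for x y
  proof -
    have "x = y" if "z \<in> Q x" "z \<in> Q y" for z
      unfolding vec_eq_iff
    proof
      fix i
      \<comment> \<open>Both bounds go through \<open>n * z $ i\<close>; integers at distance less
        than 1 coincide.\<close>
      have "real_of_int (x $ i) - 1 < real_of_int (y $ i)" "real_of_int (y $ i) - 1 < real_of_int (x $ i)"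
        using that unfolding Q by (meson less_trans)+
      then show "x $ i = y $ i" by linarith
    qed
    then show ?thesis using that by (auto simp: disjnt_def)
  qed
  have sub: "Q x \<subseteq> cube_slice s" if "x \<in> A" for x
  proof
    fix y assume y: "y \<in> Q x"
    have "0 \<le> y $ i \<and> y $ i < 1" for i
    proof -
      have "1 \<le> x $ i" "x $ i \<le> int n"
        using that assms(2) by (auto simp: int_grid_def)
      then have "1 \<le> real_of_int (x $ i)" "real_of_int (x $ i) \<le> real n"
        by linarith+
      moreover have "real_of_int (x $ i) - 1 < n * y $ i" "n * y $ i < real_of_int (x $ i)"
        using y by (auto simp: Q)
      ultimately have "0 < n * y $ i" "n * y $ i < n * 1"
        by linarith+
      then show ?thesis
        using assms(1) by (simp add: zero_less_mult_iff)
    qed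
    moreover have "(\<Sum>i\<in>UNIV. n * y $ i) \<le> (\<Sum>i\<in>UNIV. real_of_int (x $ i))"
      using y by (intro sum_mono) (auto simp: Q less_imp_le)
    then have "n * (\<Sum>i\<in>UNIV. y $ i) \<le> n * s"
      using assms(3)[OF that] by (simp add: sum_distrib_left mult.commute)
    then have "(\<Sum>i\<in>UNIV. y $ i) \<le> s"
      using assms(1) by simp
    ultimately show "y \<in> cube_slice s"
      by (auto simp: cube_slice_def)
  qed
  have mQ: "measure lebesgue (Q x) = (1 / n) ^ CARD('k)" for x
    unfolding Q_def by (rule measure_box_cart_const) simp
  have "real (card A) * (1 / n) ^ CARD('k) = (\<Sum>x\<in>A. measure lebesgue (Q x))"
    by (simp add: mQ)
  also have "\<dots> = measure lebesgue (\<Union>x\<in>A. Q x)"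
    using True disj by (subst measure_UNION') (auto simp: Q_def pairwise_def)
  also have "\<dots> \<le> measure lebesgue (cube_slice s :: (real ^ 'k) set)"
    using sub True by (intro measure_mono_fmeasurable lmeasurable_cube_slice) (auto simp: Q_def)
  finally show ?thesis
    using assms(1) by (simp add: measure_cube_slice field_simps)
next
  \<comment> \<open>Here \<open>card A\<close> is 0 by convention, so it suffices that the
    right-hand side, being a multiple of a volume, is nonnegative.\<close>
  case False
  then show ?thesis
    using measure_nonneg[of lebesgue "cube_slice s :: (real ^ 'k) set"]
    by (simp add: measure_cube_slice)
qed

section \<open>Sumfree slabs and the continuous bound\<close>

text \<open>Abstracting the coordinate sum to an additive \<open>f\<close> serves the integer and
  the real setting alike. The strict upper bound is what excludes an \<open>l\<close>-fold sum, on
  which \<open>f\<close> is at least \<open>l * t\<close>.\<close>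

lemma fold_sumfree_slab:
  fixes f :: "'a::ab_group_add \<Rightarrow> real"
  assumes "Modules.additive f" "\<And>x. x \<in> S \<Longrightarrow> t \<le> f x \<and> f x < real l * t"
  shows "fold_sumfree l S"
  unfolding fold_sumfree_def
proof (intro allI impI notI)
  fix x z assume *: "(\<forall>i<l. x i \<in> S) \<and> z \<in> S" and eq: "(\<Sum>i<l. x i) = z"
  have "real l * t \<le> (\<Sum>i<l. f (x i))"
    using * assms(2) sum_mono[of "{..<l}" "\<lambda>_. t" "\<lambda>i. f (x i)"] by auto
  also have "\<dots> = f z"
    using Modules.additive.sum[OF assms(1), of x "{..<l}"] eq by simp
  finally show False
    using * assms(2)[of z] by simp
qed

text \<open>The slab \<open>S\<close>, the lower corner and the reflected corner \<open>R\<close>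
  cover an open cube of volume 1; subadditivity bounds the volume of \<open>S\<close> from
  below.\<close>

lemma c_continuous_ge:
  assumes t: "t = real CARD('k::finite) / real (l + 1)"
  shows "ereal (1 - 2 * irwin_hall_cdf CARD('k) t) \<le> c_continuous TYPE('k) l"
proof -
  define f :: "real ^ 'k \<Rightarrow> real" where "f x = (\<Sum>i\<in>UNIV. x $ i)" for x
  \<comment> \<open>With the open cube, both \<open>x\<close> and its reflection satisfy the
    half-open constraints of \<open>cube_slice\<close>.\<close>
  define B :: "(real ^ 'k) set" where "B = box 0 (0 + (\<chi> i. 1))"
  define R :: "(real ^ 'k) set" where "R = (\<lambda>x. (-1) *\<^sub>R x + (\<chi> i. 1)) ` cube_slice t"
  define S where "S = {x \<in> B. t \<le> f x \<and> f x < real l * t}"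
  \<comment> \<open>This identity makes the two corners match: \<open>f x \<ge> l * t\<close> says
    that the reflected point has coordinate sum at most \<open>t\<close>.\<close>
  have k: "real CARD('k) = real l * t + t"
    using t by (simp add: field_simps)
  have f: "Modules.additive f"
    by unfold_locales (simp add: f_def sum.distrib)
  have B: "x \<in> B \<longleftrightarrow> (\<forall>i. 0 < x $ i \<and> x $ i < 1)" for x
    by (simp add: B_def mem_box_cart)
  have "continuous_on UNIV f"
    unfolding f_def by (intro continuous_intros)
  then have meas: "f \<in> borel_measurable borel"
    by (rule borel_measurable_continuous_onI)
  have "S \<in> sets borel"
    unfolding S_def B_def using meas by measurable
  then have S: "S \<in> sets lebesgue"
    by auto
  have cover: "B \<subseteq> S \<union> (cube_slice t \<union> R)"
  proof
    fix x assume x: "x \<in> B"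
    consider "x \<in> S" | "f x < t" | "real l * t \<le> f x"
      using x unfolding S_def mem_Collect_eq by (meson not_le)
    then show "x \<in> S \<union> (cube_slice t \<union> R)"
    proof cases
      case 2
      then have "x \<in> cube_slice t"
        using x by (auto simp: B cube_slice_def f_def less_imp_le)
      then show ?thesis by blast
    next
      case 3
      then have "(\<chi> i. 1) - x \<in> cube_slice t"
        using x k by (auto simp: B cube_slice_def f_def less_imp_le sum_subtractf)
      then show ?thesis
        unfolding R_def by (intro UnI2 image_eqI[of _ _ "(\<chi> i. 1) - x"]) auto
    qed auto
  qed
  have "B \<in> lmeasurable"
    unfolding B_def by (rule lmeasurable_box)
  then have Sl: "S \<in> lmeasurable"
    by (rule fmeasurableI2) (use S in \<open>auto simp: S_def\<close>)
  have slice: "cube_slice t \<in> (lmeasurable :: (real ^ 'k) set set)"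
    by (rule lmeasurable_cube_slice)
  have "emeasure lebesgue R = emeasure lebesgue (cube_slice t :: (real ^ 'k) set)"
    unfolding R_def by (simp only: emeasure_lebesgue_affine) simp
  \<comment> \<open>Differentiable maps between spaces of equal dimension preserve Lebesgue
    measurability; finiteness comes from the equality of \<open>emeasure\<close> just shown.\<close>
  moreover have "R \<in> sets lebesgue"
    unfolding R_def
    by (intro differentiable_image_in_sets_lebesgue fmeasurableD slice order.refl derivative_intros)
  ultimately have refl: "R \<in> lmeasurable"
    using slice unfolding fmeasurable_def mem_Collect_eq by argo
  have "1 = measure lebesgue B"
    unfolding B_def by (subst measure_box_cart_const) auto
  also have "\<dots> \<le> measure lebesgue (S \<union> (cube_slice t \<union> R))"
    by (intro measure_mono_fmeasurable cover fmeasurable.Un Sl slice refl)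
       (auto simp: B_def)
  also have "\<dots> \<le> measure lebesgue S + (measure lebesgue (cube_slice t :: (real ^ 'k) set) +
      measure lebesgue R)"
    by (rule order.trans[OF measure_Un_le add_left_mono[OF measure_Un_le]])
       (use S fmeasurableD[OF slice] fmeasurableD[OF refl] in auto)
  also have "\<dots> = measure lebesgue S + 2 * irwin_hall_cdf CARD('k) t"
    unfolding R_def by (simp only: measure_lebesgue_affine measure_cube_slice) simp
  finally have "1 - 2 * irwin_hall_cdf CARD('k) t \<le> measure lebesgue S"
    by simp
  moreover have "fold_sumfree l S"
    using f by (rule fold_sumfree_slab) (auto simp: S_def)
  moreover have "S \<subseteq> unit_cube"
    by (auto simp: S_def B unit_cube_def less_imp_le)
  ultimately show ?thesis
    unfolding c_continuous_def using S by (intro Sup_upper2[of "ereal (measure lebesgue S)"]) auto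
qed

section \<open>The discrete bound\<close>

lemma bij_betw_int_grid:
  "bij_betw (\<lambda>f. \<chi> i. f i) (PiE UNIV (\<lambda>_. {1..int n})) (int_grid n :: (int ^ 'k::finite) set)"
  by (rule bij_betwI[of _ _ _ "\<lambda>x i. x $ i"]) (auto simp: int_grid_def PiE_def extensional_def)

lemma finite_int_grid: "finite (int_grid n :: (int ^ 'k::finite) set)"
  using bij_betw_finite[OF bij_betw_int_grid[of n, where 'k='k]] by (auto intro: finite_PiE)

lemma card_int_grid: "card (int_grid n :: (int ^ 'k::finite) set) = n ^ CARD('k)"
  using bij_betw_same_card[OF bij_betw_int_grid[of n, where 'k='k]] by (simp add: card_PiE)

text \<open>The grid is covered by the slab \<open>S\<close>, the lower corner \<open>L\<close> and
  the upper corner \<open>U\<close>, with all thresholds scaled by \<open>n\<close>. Counting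
  \<open>L\<close> and the reflection of \<open>U\<close> by volume leaves the stated number for
  \<open>S\<close>.\<close>

lemma Max_fold_sumfree_ge:
  assumes t: "t = real CARD('k::finite) / real (l + 1)" and n: "n > 0"
  shows "1 - irwin_hall_cdf CARD('k) t - irwin_hall_cdf CARD('k) (t + real CARD('k) / real n)
    \<le> 1 / real n ^ CARD('k) *
       real (Max {card S | S :: (int ^ 'k) set. S \<subseteq> int_grid n \<and> fold_sumfree l S})"
proof -
  define f :: "int ^ 'k \<Rightarrow> real" where "f x = real_of_int (\<Sum>i\<in>UNIV. x $ i)" for x
  define S where "S = {x \<in> int_grid n. t * n \<le> f x \<and> f x < real l * (t * n)}"
  define L where "L = {x \<in> int_grid n. f x < t * n}"
  define U where "U = {x \<in> int_grid n. real l * (t * n) \<le> f x}"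
  \<comment> \<open>Reflection of \<open>{1..n}\<close> sends a coordinate to \<open>n + 1\<close>
    minus itself. Compared with reflection in \<open>n\<close>, the coordinate sum gains
    \<open>CARD('k)\<close>, which becomes the shift \<open>CARD('k) / n\<close> after
    rescaling.\<close>
  define r :: "int ^ 'k \<Rightarrow> int ^ 'k" where "r x = (\<chi> i. int n + 1) - x" for x
  let ?F = "irwin_hall_cdf CARD('k)"
  have k: "real CARD('k) = real l * t + t"
    using t by (simp add: field_simps)
  have L: "real (card L) \<le> real n ^ CARD('k) * ?F t"
    using n by (intro card_le_irwin_hall_cdf) (auto simp: L_def f_def)
  have "card U = card (r ` U)"
    by (rule card_image[symmetric]) (auto simp: r_def inj_on_def)
  also have "real \<dots> \<le> real n ^ CARD('k) * ?F (t + real CARD('k) / real n)"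
  proof (rule card_le_irwin_hall_cdf)
    show "r ` U \<subseteq> int_grid n"
      by (auto simp: r_def U_def int_grid_def)
    fix y assume "y \<in> r ` U"
    then obtain x where x: "x \<in> U" "y = r x" by blast
    have "real_of_int (\<Sum>i\<in>UNIV. y $ i) = real CARD('k) * (real n + 1) - f x"
      by (simp add: x(2) r_def f_def sum_subtractf)
    also have "\<dots> \<le> real CARD('k) * (real n + 1) - real l * (t * n)"
      using x(1) by (simp add: U_def)
    also have "\<dots> = (t + real CARD('k) / real n) * real n"
      using n k by (simp add: field_simps)
    finally show "real_of_int (\<Sum>i\<in>UNIV. y $ i) \<le> (t + real CARD('k) / real n) * real n" .
  qed (fact n)
  finally have U: "real (card U) \<le> real n ^ CARD('k) * ?F (t + real CARD('k) / real n)" .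
  have "int_grid n = S \<union> (L \<union> U)"
    by (auto simp: S_def L_def U_def)
  then have "n ^ CARD('k) \<le> card S + (card L + card U)"
    using card_Un_le[of S "L \<union> U"] card_Un_le[of L U] card_int_grid[of n, where 'k='k] by simp
  then have "real n ^ CARD('k) \<le> real (card S) + (real (card L) + real (card U))"
    by (metis of_nat_add of_nat_le_iff of_nat_power)
  with L U have "real n ^ CARD('k) * (1 - ?F t - ?F (t + real CARD('k) / real n)) \<le> real (card S)"
    by (simp add: algebra_simps)
  then have "1 - ?F t - ?F (t + real CARD('k) / real n) \<le> 1 / real n ^ CARD('k) * real (card S)"
    using n by (simp add: field_simps)
  also have "\<dots> \<le> 1 / real n ^ CARD('k) *
       real (Max {card S | S :: (int ^ 'k) set. S \<subseteq> int_grid n \<and> fold_sumfree l S})"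
  proof (intro mult_left_mono of_nat_mono Max_ge)
    show "finite {card S | S :: (int ^ 'k) set. S \<subseteq> int_grid n \<and> fold_sumfree l S}"
      by (rule finite_subset[of _ "card ` Pow (int_grid n :: (int ^ 'k) set)"])
         (auto simp: finite_int_grid)
    have "Modules.additive f"
      by unfold_locales (simp add: f_def sum.distrib)
    then have "fold_sumfree l S"
      by (rule fold_sumfree_slab) (auto simp: S_def)
    then show "card S \<in> {card S | S :: (int ^ 'k) set. S \<subseteq> int_grid n \<and> fold_sumfree l S}"
      by (auto simp: S_def)
  qed simp
  finally show ?thesis .
qed

text \<open>The shift in the bound for fixed \<open>n\<close> tends to 0, so by continuity the
  bounds converge to the claimed value, and their limit superior is that limit.\<close>

lemma c_discrete_ge:
  assumes t: "t = real CARD('k::finite) / real (l + 1)"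
  shows "ereal (1 - 2 * irwin_hall_cdf CARD('k) t) \<le> c_discrete TYPE('k) l"
proof -
  let ?F = "irwin_hall_cdf CARD('k)"
  let ?g = "\<lambda>n. 1 - ?F t - ?F (t + real CARD('k) / real n)"
  have "(\<lambda>n. t + real CARD('k) / real n) \<longlonglongrightarrow> t + 0"
    by (intro tendsto_intros lim_const_over_n)
  then have "(\<lambda>n. ?F (t + real CARD('k) / real n)) \<longlonglongrightarrow> ?F t"
    using isCont_tendsto_compose[OF continuous_irwin_hall_cdf] by fastforce
  then have "?g \<longlonglongrightarrow> 1 - ?F t - ?F t"
    by (intro tendsto_intros)
  then have "limsup (\<lambda>n. ereal (?g n)) = ereal (1 - 2 * ?F t)"
    by (intro lim_imp_Limsup) auto
  \<comment> \<open>The finite bound holds for \<open>n > 0\<close>, which is enough for a limit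
    superior.\<close>
  moreover have "limsup (\<lambda>n. ereal (?g n)) \<le> c_discrete TYPE('k) l"
    unfolding c_discrete_def
    by (intro Limsup_mono eventually_mono[OF eventually_gt_at_top[of 0]])
       (use Max_fold_sumfree_ge[OF t] in simp)
  ultimately show ?thesis
    by simp
qed

theorem theorem6p1:
  fixes k l :: nat
  assumes "k = CARD('k::finite)" and "l \<ge> 2"
  shows "c_discrete TYPE('k) l \<ge>
           ereal (1 - 2 / fact k * (\<Sum>i = 0..nat \<lfloor>real k / real (l + 1)\<rfloor>.
             (-1) ^ i * real (k choose i) * (real k / real (l + 1) - real i) ^ k))
       \<and> c_continuous TYPE('k) l \<ge>
           ereal (1 - 2 / fact k * (\<Sum>i = 0..nat \<lfloor>real k / real (l + 1)\<rfloor>.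
             (-1) ^ i * real (k choose i) * (real k / real (l + 1) - real i) ^ k))"
proof -
  let ?t = "real k / real (l + 1)"
  have "k \<ge> 1"
    using assms(1) by (simp add: Suc_le_eq)
  \<comment> \<open>Ensures that the floor of \<open>?t\<close> does not exceed \<open>k\<close>, as
    needed to identify the stated sum with \<open>irwin_hall_cdf\<close>.\<close>
  moreover have "?t \<le> real k"
    by (simp add: divide_le_eq distrib_left)
  ultimately have "2 / fact k * (\<Sum>i = 0..nat \<lfloor>?t\<rfloor>. (-1) ^ i * real (k choose i) * (?t - real i) ^ k)
      = 2 * irwin_hall_cdf k ?t"
    by (subst irwin_hall_cdf_truncate) auto
  then show ?thesis
    using c_discrete_ge[of ?t l, where 'k='k] c_continuous_ge[of ?t l, where 'k='k] assms(1)
    by simp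
qed

end
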